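(* For any prime $p$ and any positive integer $k$, where $C\subset\mathbb{R}^2$ is (the vertex set of) a regular $p$-gon, there is some positive integer $n$ such that every colouring of $p^{-p/2}C^n$ (with any number of colours) contains either a monochromatic copy of $C^k$ or a rainbow copy of $C^k$.
   Context: For a positive integer $n$, $C^n=C\times\dots\times C\subset(\mathbb{R}^2)^n=\mathbb{R}^{2n}$ is the $n$-fold Cartesian power with Euclidean distance, and for $\lambda>0$, $\lambda C^n=\{\lambda x: x\in C^n\}$ is its dilation by $\lambda$. A copy of a finite point set $D$ in a set $S$ is a subset $X\subset S$ such that there is a surjective isometry (for Euclidean distance) $D\to X$. A colouring of $S$ is an arbitrary map from $S$ to some set, with no bound on the number of colours (equivalently, an equivalence relation on $S$). A copy $X$ is monochromatic if all its points receive the same colour, and rainbow if its points receive pairwise different colours. For $p=2$ a regular $2$-gon is understood as a pair of distinct points. *)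

theory Defs
  imports "HOL-Analysis.Analysis" "HOL-Computational_Algebra.Primes"
begin

text \<open>
  Points of \<open>(\<real>\<^sup>2)\<^sup>n\<close> are extensional functions on \<open>{..<n}\<close> with values in \<^typ>\<open>real^2\<close>,
  so that the dimension \<open>n\<close> can be quantified inside a formula.
\<close>

type_synonym point = "nat \<Rightarrow> real^2"

definition cart_pow :: "(real^2) set \<Rightarrow> nat \<Rightarrow> point set" where
  "cart_pow C n = {..<n} \<rightarrow>\<^sub>E C"

definition edist :: "nat \<Rightarrow> point \<Rightarrow> point \<Rightarrow> real" where
  "edist n x y = L2_set (\<lambda>i. dist (x i) (y i)) {..<n}"

definition dilate :: "nat \<Rightarrow> real \<Rightarrow> point set \<Rightarrow> point set" where
  "dilate n c S = (\<lambda>x. \<lambda>i\<in>{..<n}. c *\<^sub>R x i) ` S"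

text \<open>
  Vertex sets of regular \<open>m\<close>-gons with arbitrary centre, circumradius and orientation.
  For \<open>m = 2\<close> these are exactly the pairs of distinct points.
\<close>

definition regular_polygon :: "nat \<Rightarrow> (real^2) set \<Rightarrow> bool" where
  "regular_polygon m C \<longleftrightarrow>
     (\<exists>a r \<theta>. r > 0 \<and>
        C = (\<lambda>j. a + r *\<^sub>R vector [cos (\<theta> + 2 * pi * real j / real m),
                                   sin (\<theta> + 2 * pi * real j / real m)]) ` {..<m})"

text \<open>\<open>X\<close> is a copy in \<open>S \<subseteq> (\<real>\<^sup>2)\<^sup>n\<close> of \<open>D \<subseteq> (\<real>\<^sup>2)\<^sup>k\<close>.\<close>

definition copy_in :: "nat \<Rightarrow> point set \<Rightarrow> nat \<Rightarrow> point set \<Rightarrow> point set \<Rightarrow> bool" where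
  "copy_in k D n S X \<longleftrightarrow> X \<subseteq> S \<and>
     (\<exists>g. g ` D = X \<and> (\<forall>x\<in>D. \<forall>y\<in>D. edist n (g x) (g y) = edist k x y))"

text \<open>
  A colouring of \<open>S\<close> with an unrestricted set of colours is given by an equivalence relation \<open>R\<close>
  on \<open>S\<close> (having the same colour). Quantifying over equivalence relations rather than over maps
  into a type of colours makes statements of the form ``there is \<open>n\<close> such that every colouring
  \<open>\<dots>\<close>'' uniform in the type of colours; the lemmas \<open>colouring_kernel\<close> and \<open>kernel_colouring\<close>
  show that this covers exactly the maps from \<open>S\<close> into arbitrary types.
\<close>

definition colouring :: "'a set \<Rightarrow> ('a \<times> 'a) set \<Rightarrow> bool" where
  "colouring S R \<longleftrightarrow> equiv S R"

definition monochromatic :: "('a \<times> 'a) set \<Rightarrow> 'a set \<Rightarrow> bool" where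
  "monochromatic R X \<longleftrightarrow> (\<forall>x\<in>X. \<forall>y\<in>X. (x, y) \<in> R)"

definition rainbow :: "('a \<times> 'a) set \<Rightarrow> 'a set \<Rightarrow> bool" where
  "rainbow R X \<longleftrightarrow> (\<forall>x\<in>X. \<forall>y\<in>X. x \<noteq> y \<longrightarrow> (x, y) \<notin> R)"

lemma colouring_kernel:
  fixes f :: "'a \<Rightarrow> 'c" and S :: "'a set"
  defines "R \<equiv> {(x, y) \<in> S \<times> S. f x = f y}"
  shows "colouring S R"
    and "X \<subseteq> S \<Longrightarrow> monochromatic R X \<longleftrightarrow> (\<forall>x\<in>X. \<forall>y\<in>X. f x = f y)"
    and "X \<subseteq> S \<Longrightarrow> rainbow R X \<longleftrightarrow> inj_on f X"
proof -
  show "colouring S R"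
    unfolding R_def colouring_def by (rule equivI) (auto simp: refl_on_def sym_def trans_def)
  show "monochromatic R X \<longleftrightarrow> (\<forall>x\<in>X. \<forall>y\<in>X. f x = f y)" if "X \<subseteq> S"
    using that unfolding R_def monochromatic_def by blast
  show "rainbow R X \<longleftrightarrow> inj_on f X" if "X \<subseteq> S"
    using that unfolding R_def rainbow_def inj_on_def by blast
qed

lemma kernel_colouring:
  assumes "colouring S R"
  obtains f :: "'a \<Rightarrow> 'a set" where "R = {(x, y) \<in> S \<times> S. f x = f y}"
proof
  show "R = {(x, y) \<in> S \<times> S. R `` {x} = R `` {y}}"
    using equiv_class_eq_iff[OF assms[unfolded colouring_def]] by blast
qed

end

theory Submission
  imports "HOL-Library.Ramsey" Defs "HOL-Number_Theory.Cong"
begin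

text \<open>
  Number the vertices of \<open>C\<close> cyclically. The points of \<open>C\<^sup>n\<close> become words of length \<open>n\<close> over
  \<open>\<int>/p\<close>, and the squared distance of two words is a sum over the coordinates of a function
  \<open>D(a, b)\<close> that is invariant under \<open>(a, b) \<mapsto> (a + 1, b + 1)\<close>. A map from words of length \<open>k\<close> to words
  of length \<open>n\<close> that uses each of the \<open>k\<close> letters in exactly \<open>q\<close> coordinates, shifted by arbitrary
  constants, and is constant in the other coordinates multiplies squared distances by \<open>q\<close>. So the task is to find such a map, with
  \<open>q = p\<^sup>p\<close>, on whose image the colouring is constant or injective.

  The basic block is \<open>\<rho>(a) = (a, a + 1, \<dots>, a + p - 1)\<close>: it costs a factor \<open>p\<close>, and \<open>\<rho>(a + 1)\<close> arises
  from \<open>\<rho>(a)\<close> by moving the first letter to the end. Let \<open>E\<close> be the relation of having the same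
  colour. The key is to ask at first not whether a single word keeps its colour under a change, but
  whether \<open>E x y\<close> is preserved when \<open>x\<close> and \<open>y\<close> are changed simultaneously at a coordinate where
  they agree. As \<open>E x y\<close> has only two possible values, finite Ramsey applies to it although the
  number of colours is unbounded.

  By Ramsey's theorem one passes to a set of coordinates on which a common letter \<open>0\<close> commutes with
  its neighbour (\<open>ramsey_zero_commutes\<close>). If, moreover, the common letters \<open>0, \<dots>, s\<close> are
  interchangeable, then each of them commutes with its neighbour, hence can be moved from the
  beginning of a block to its end; so for words of blocks the common letters \<open>0, \<dots>, s + 1\<close> are
  interchangeable (\<open>interchangeable_blocks\<close>). After \<open>p - 1\<close> steps, at a cost of \<open>p\<^bsup>p - 1\<^esup>\<close>, all common
  letters are interchangeable (\<open>interchangeable_subspace\<close>).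

  Use Ramsey's theorem once more. Whether a word keeps its colour when two adjacent letters \<open>a\<close>,
  \<open>b\<close> are exchanged now depends only on \<open>a\<close> and \<open>b\<close>, and this is an equivalence relation \<open>a \<approx> b\<close> on
  \<open>\<int>/p\<close> (\<open>exchange_context\<close>, \<open>exchange_position\<close>, \<open>exchange_trans\<close>). Pass to blocks a last time, for the
  remaining factor \<open>p\<close>. If \<open>\<approx>\<close> is total, then all words of blocks have the same colour, since
  rotations of a block are compositions of exchanges (\<open>monochromatic_blocks\<close>). Otherwise all of
  them have different colours. Indeed, if two words of the same colour have letters \<open>a\<close> and \<open>b\<close> at
  some coordinate, then \<open>a \<approx> b\<close> (\<open>exchange_if_same_colour\<close>). If the words consist of blocks, and
  \<open>\<rho>(a)\<close> and \<open>\<rho>(b)\<close> with \<open>a \<noteq> b\<close> are corresponding blocks, this gives \<open>a + r \<approx> b + r\<close> for all \<open>r\<close>,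
  and as \<open>p\<close> is prime, \<open>\<approx>\<close> would be total after all (\<open>translation_closed_total\<close>).
\<close>

section \<open>Words and maps that scale squared distances\<close>

type_synonym word = "nat \<Rightarrow> nat"

text \<open>
  Letters are natural numbers that are only ever compared modulo \<open>p\<close>, and a word of length \<open>n\<close> is a
  function of which only the values below \<open>n\<close> matter. This avoids side conditions on letters and
  lengths: an equivalence relation that contains \<open>agree p n\<close> cannot see the difference.
\<close>

definition agree :: "nat \<Rightarrow> nat \<Rightarrow> word \<Rightarrow> word \<Rightarrow> bool" where
  "agree p n x y \<longleftrightarrow> (\<forall>i<n. x i mod p = y i mod p)"

definition word_colouring :: "nat \<Rightarrow> nat \<Rightarrow> (word \<Rightarrow> word \<Rightarrow> bool) \<Rightarrow> bool" where
  "word_colouring p n E \<longleftrightarrow> equivp E \<and> (\<forall>x y. agree p n x y \<longrightarrow> E x y)"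

text \<open>
  Here \<open>D\<close> stands for a squared distance of letters. Quantifying over all translation-invariant \<open>D\<close>
  makes the notion independent of the polygon.
\<close>

definition scaled_map :: "nat \<Rightarrow> nat \<Rightarrow> nat \<Rightarrow> nat \<Rightarrow> (word \<Rightarrow> word) \<Rightarrow> bool" where
  "scaled_map p q m n g \<longleftrightarrow>
     (\<forall>x y. agree p m x y \<longrightarrow> agree p n (g x) (g y)) \<and>
     (\<forall>(D :: nat \<Rightarrow> nat \<Rightarrow> real) x y. (\<forall>a. D a a = 0) \<longrightarrow> (\<forall>a b r. D (a + r) (b + r) = D a b) \<longrightarrow>
        (\<Sum>i<n. D (g x i) (g y i)) = real q * (\<Sum>j<m. D (x j) (y j)))"

abbreviation pullback :: "(word \<Rightarrow> word) \<Rightarrow> (word \<Rightarrow> word \<Rightarrow> bool) \<Rightarrow> word \<Rightarrow> word \<Rightarrow> bool" where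
  "pullback g E \<equiv> \<lambda>x y. E (g x) (g y)"

text \<open>
  A letter that two words have in common at some coordinate can be replaced, in both of them
  simultaneously, by any other letter in \<open>{0..s}\<close> without affecting whether their colours are equal;
  the steps from \<open>a < s\<close> to \<open>a + 1\<close> generate all such replacements.
\<close>

definition interchangeable :: "nat \<Rightarrow> nat \<Rightarrow> (word \<Rightarrow> word \<Rightarrow> bool) \<Rightarrow> bool" where
  "interchangeable s n E \<longleftrightarrow> (\<forall>x y i. i < n \<longrightarrow> x i = y i \<longrightarrow> x i < s \<longrightarrow>
     E x y = E (x(i := Suc (x i))) (y(i := Suc (y i))))"

definition swap_at :: "nat \<Rightarrow> word \<Rightarrow> word" where
  "swap_at i x = x(i := x (Suc i), Suc i := x i)"

definition zero_commutes :: "nat \<Rightarrow> (word \<Rightarrow> word \<Rightarrow> bool) \<Rightarrow> bool" where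
  "zero_commutes n E \<longleftrightarrow> (\<forall>x y i. Suc i < n \<longrightarrow> x i = 0 \<longrightarrow> y i = 0 \<longrightarrow>
     E x y = E (swap_at i x) (swap_at i y))"

lemma word_colouring_equivp: "word_colouring p n E \<Longrightarrow> equivp E"
  by (simp add: word_colouring_def)

lemmas word_colouring_refl = equivp_reflp[OF word_colouring_equivp]
lemmas word_colouring_sym = equivp_symp[OF word_colouring_equivp]
lemmas word_colouring_trans = equivp_transp[OF word_colouring_equivp]

lemma word_colouring_agree: "word_colouring p n E \<Longrightarrow> agree p n x y \<Longrightarrow> E x y"
  by (simp add: word_colouring_def)

lemma agree_sym: "agree p n x y \<Longrightarrow> agree p n y x"
  by (simp add: agree_def)

lemma word_colouring_cong:
  assumes "word_colouring p n E" "agree p n x x'" "agree p n y y'"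
  shows "E x y = E x' y'"
proof -
  have "E x x'" "E x' x" "E y y'" "E y' y"
    using assms agree_sym word_colouring_agree by blast+
  then show ?thesis
    using word_colouring_trans[OF assms(1)] by blast
qed

lemma word_colouring_pullback:
  assumes "word_colouring p n E" "scaled_map p q m n g"
  shows "word_colouring p m (pullback g E)"
proof -
  have "equivp (pullback g E)"
    using word_colouring_refl[OF assms(1)] word_colouring_sym[OF assms(1)]
      word_colouring_trans[OF assms(1)]
    by (intro equivpI reflpI sympI transpI) blast+
  then show ?thesis
    using assms unfolding word_colouring_def scaled_map_def by blast
qed

lemma scaled_map_sum:
  fixes D :: "nat \<Rightarrow> nat \<Rightarrow> real"
  assumes "scaled_map p q m n g" "\<And>a. D a a = 0" "\<And>a b r. D (a + r) (b + r) = D a b"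
  shows "(\<Sum>i<n. D (g x i) (g y i)) = real q * (\<Sum>j<m. D (x j) (y j))"
  using assms unfolding scaled_map_def by blast

lemma scaled_map_id: "scaled_map p 1 n n (\<lambda>x. x)"
  by (simp add: scaled_map_def)

lemma scaled_map_comp:
  assumes f: "scaled_map p q l m f" and g: "scaled_map p r m n g"
  shows "scaled_map p (q * r) l n (\<lambda>x. g (f x))"
proof -
  have "(\<Sum>i<n. D (g (f x) i) (g (f y) i)) = real (q * r) * (\<Sum>j<l. D (x j) (y j))"
    if "\<forall>a. D a a = 0" "\<forall>a b r. D (a + r) (b + r) = D a b" for D :: "nat \<Rightarrow> nat \<Rightarrow> real" and x y
  proof -
    have "(\<Sum>i<n. D (g (f x) i) (g (f y) i)) = real r * (\<Sum>i<m. D (f x i) (f y i))"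
      using g that unfolding scaled_map_def by blast
    also have "(\<Sum>i<m. D (f x i) (f y i)) = real q * (\<Sum>j<l. D (x j) (y j))"
      using f that unfolding scaled_map_def by blast
    finally show ?thesis by simp
  qed
  then show ?thesis
    using f g unfolding scaled_map_def by blast
qed

section \<open>Making a common zero move freely\<close>

lemma ramsey_finite_colours:
  "\<exists>N. \<forall>(f :: nat set \<Rightarrow> 'c) C. finite C \<longrightarrow> card C = c \<longrightarrow> (\<forall>S. f S \<in> C) \<longrightarrow>
     (\<exists>H\<subseteq>{..<N}. card H = q \<and> (\<forall>S T. S \<subseteq> H \<longrightarrow> T \<subseteq> H \<longrightarrow> card S = r \<longrightarrow> card T = r \<longrightarrow> f S = f T))"
proof -
  obtain N :: nat where N: "partn_lst {..<N} (replicate c q) r"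
    using ramsey_full by blast
  show ?thesis
  proof (intro exI[of _ N] allI impI)
    fix f :: "nat set \<Rightarrow> 'c" and C
    assume C: "finite C" "card C = c" and fC: "\<forall>S. f S \<in> C"
    obtain e where e: "bij_betw e C {0..<c}"
      using C ex_bij_betw_finite_nat by blast
    have "(\<lambda>S. e (f S)) \<in> nsets {..<N} r \<rightarrow> {..<c}"
      using e fC by (fastforce simp: bij_betw_def)
    then obtain i H where i: "i < c" and H: "H \<in> nsets {..<N} (replicate c q ! i)"
      and mono: "(\<lambda>S. e (f S)) ` nsets H r \<subseteq> {i}"
      by (rule partn_lstE[OF N, where l = c]) auto
    have H': "H \<subseteq> {..<N}" "finite H" "card H = q"
      using H i by (auto simp: nsets_def)
    have "f S = f T" if "S \<subseteq> H" "T \<subseteq> H" "card S = r" "card T = r" for S T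
    proof -
      have "S \<in> nsets H r" "T \<in> nsets H r"
        using that H'(2) finite_subset by (auto simp: nsets_def)
      then have "e (f S) = e (f T)"
        using mono by blast
      then show ?thesis
        using e fC by (auto simp: bij_betw_def inj_on_def)
    qed
    then show "\<exists>H\<subseteq>{..<N}. card H = q \<and>
        (\<forall>S T. S \<subseteq> H \<longrightarrow> T \<subseteq> H \<longrightarrow> card S = r \<longrightarrow> card T = r \<longrightarrow> f S = f T)"
      using H' by blast
  qed
qed

text \<open>
  On \<open>H\<close> this is the inverse of its increasing enumeration.
\<close>

definition index_in :: "nat set \<Rightarrow> nat \<Rightarrow> nat" where
  "index_in H k = card {h\<in>H. h < k}"

definition spread :: "nat set \<Rightarrow> word \<Rightarrow> word" where
  "spread H x k = (if k \<in> H then x (index_in H k) else 0)"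

lemma index_in_strict_mono:
  assumes "finite H" "h \<in> H" "h < k"
  shows "index_in H h < index_in H k"
  unfolding index_in_def using assms by (intro psubset_card_mono) auto

lemma index_in_less: "finite H \<Longrightarrow> h \<in> H \<Longrightarrow> index_in H h < card H"
  unfolding index_in_def by (intro psubset_card_mono) auto

lemma bij_betw_index_in:
  assumes "finite H"
  shows "bij_betw (index_in H) H {..<card H}"
proof -
  have inj: "inj_on (index_in H) H"
    using index_in_strict_mono[OF assms] by (intro linorder_inj_onI) (auto dest: less_imp_neq)
  moreover have "index_in H ` H = {..<card H}"
    using inj assms index_in_less by (intro card_subset_eq) (auto simp: card_image)
  ultimately show ?thesis by (simp add: bij_betw_def)
qed

lemma index_in_remove:
  assumes "finite H" "h \<in> H"
  shows "index_in (H - {h}) k = (if h < k then index_in H k - 1 else index_in H k)"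
proof -
  have "{h' \<in> H - {h}. h' < k} = {h'\<in>H. h' < k} - {h}" by auto
  then show ?thesis
    using assms by (simp add: index_in_def)
qed

lemma scaled_map_spread:
  assumes "H \<subseteq> {..<N}" "card H = q"
  shows "scaled_map p 1 q N (spread H)"
proof -
  have fin: "finite H" using assms finite_subset by blast
  have "agree p N (spread H x) (spread H y)" if "agree p q x y" for x y
    using that assms index_in_less[OF fin] by (auto simp: agree_def spread_def)
  moreover have "(\<Sum>i<N. D (spread H x i) (spread H y i)) = real 1 * (\<Sum>j<q. D (x j) (y j))"
    if "\<forall>a. D a a = 0" for D :: "nat \<Rightarrow> nat \<Rightarrow> real" and x y
  proof -
    have "(\<Sum>i<N. D (spread H x i) (spread H y i)) = (\<Sum>i\<in>H. D (spread H x i) (spread H y i))"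
      using assms that by (intro sum.mono_neutral_right) (auto simp: spread_def)
    also have "\<dots> = (\<Sum>i\<in>H. D (x (index_in H i)) (y (index_in H i)))"
      by (simp add: spread_def)
    also have "\<dots> = (\<Sum>j<q. D (x j) (y j))"
      using sum.reindex_bij_betw[OF bij_betw_index_in[OF fin]] assms(2) by simp
    finally show ?thesis by simp
  qed
  ultimately show ?thesis by (simp add: scaled_map_def)
qed

text \<open>
  A letter \<open>0\<close> cannot be told from an unused coordinate. This is what lets Ramsey's theorem for
  subsets with one element fewer than \<open>H\<close> speak about words on \<open>H\<close>.
\<close>

lemma spread_remove_zero:
  assumes "finite H" "h \<in> H" "x (index_in H h) = 0"
  shows "spread H x = spread (H - {h}) (\<lambda>j. if j < index_in H h then x j else x (Suc j))"
proof
  fix k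
  consider "k \<notin> H" | "k = h" | "k \<in> H" "k < h" | "k \<in> H" "h < k" by force
  then show "spread H x k = spread (H - {h}) (\<lambda>j. if j < index_in H h then x j else x (Suc j)) k"
  proof cases
    case 3
    then show ?thesis
      using index_in_strict_mono[OF assms(1), of k h] assms by (simp add: spread_def index_in_remove)
  next
    case 4
    then show ?thesis
      using index_in_strict_mono[OF assms(1), of h k] assms by (simp add: spread_def index_in_remove)
  qed (use assms in \<open>auto simp: spread_def\<close>)
qed

lemma spread_fun_upd:
  assumes "finite H" "h \<in> H"
  shows "spread H (x(index_in H h := a)) = (spread H x)(h := a)"
proof
  fix k
  have "index_in H k = index_in H h \<longleftrightarrow> k = h" if "k \<in> H"
    using bij_betw_index_in[OF assms(1)] assms that by (auto simp: bij_betw_def inj_on_def)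
  then show "spread H (x(index_in H h := a)) k = ((spread H x)(h := a)) k"
    using assms by (auto simp: spread_def)
qed

lemma interchangeable_spread:
  assumes "interchangeable s N E" "H \<subseteq> {..<N}" "card H = q"
  shows "interchangeable s q (pullback (spread H) E)"
  unfolding interchangeable_def
proof (intro allI impI)
  fix x y i assume i: "i < q" "x i = y i" "x i < s"
  have fin: "finite H" using assms finite_subset by blast
  obtain h where h: "h \<in> H" "index_in H h = i"
    using bij_betw_index_in[OF fin] i assms(3) by (metis bij_betwE bij_betw_imp_surj_on imageE lessThan_iff)
  have xy: "spread H x h = x i" "spread H y h = y i"
    using h by (auto simp: spread_def)
  show "E (spread H x) (spread H y) =
      E (spread H (x(i := Suc (x i)))) (spread H (y(i := Suc (y i))))"
    using assms(1,2) h i xy spread_fun_upd[OF fin h(1)]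
    unfolding interchangeable_def by (metis lessThan_iff subsetD)
qed

text \<open>
  Colour a set \<open>S\<close> of \<open>q - 1\<close> coordinates by the restriction of \<open>E\<close> to the words supported on \<open>S\<close>;
  there are finitely many such relations. Let \<open>H\<close> be a homogeneous set with \<open>q\<close> elements. Two words
  on \<open>H\<close> with a common \<open>0\<close> are words supported on \<open>H\<close> without one element, and exchanging this \<open>0\<close>
  with its right neighbour only changes which element is left out.
\<close>

lemma ramsey_zero_commutes:
  assumes "p > 0"
  shows "\<exists>N. \<forall>E. word_colouring p N E \<longrightarrow>
     (\<exists>g. scaled_map p 1 q N g \<and> zero_commutes q (pullback g E) \<and>
        (\<forall>s. interchangeable s N E \<longrightarrow> interchangeable s q (pullback g E)))"
proof -
  \<comment> \<open>representatives of the words of length \<open>q - 1\<close>, to keep the number of colours finite\<close>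
  define W where "W = ({..<q - 1} \<rightarrow>\<^sub>E {..<p})"
  have finW: "finite (Pow (W \<times> W))"
    by (simp add: W_def finite_PiE)
  obtain N where N: "\<And>(f :: nat set \<Rightarrow> (word \<times> word) set). (\<forall>S. f S \<in> Pow (W \<times> W)) \<Longrightarrow>
     (\<exists>H\<subseteq>{..<N}. card H = q \<and>
       (\<forall>S T. S \<subseteq> H \<longrightarrow> T \<subseteq> H \<longrightarrow> card S = q - 1 \<longrightarrow> card T = q - 1 \<longrightarrow> f S = f T))"
    using ramsey_finite_colours[where 'c = "(word \<times> word) set" and c = "card (Pow (W \<times> W))"
        and q = q and r = "q - 1"] finW by metis
  show ?thesis
  proof (intro exI[of _ N] allI impI)
    fix E assume E: "word_colouring p N E"
    define f where "f S = {(u, v) \<in> W \<times> W. E (spread S u) (spread S v)}" for S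
    obtain H where H: "H \<subseteq> {..<N}" "card H = q"
      and hom: "\<And>S T. S \<subseteq> H \<Longrightarrow> T \<subseteq> H \<Longrightarrow> card S = q - 1 \<Longrightarrow> card T = q - 1 \<Longrightarrow> f S = f T"
    proof -
      have "\<forall>S. f S \<in> Pow (W \<times> W)"
        by (auto simp: f_def)
      from N[OF this] show thesis
        using that by blast
    qed
    have fin: "finite H" using H finite_subset by blast
    have same: "E (spread S u) (spread S v) = E (spread T u) (spread T v)"
      if ST: "S \<subseteq> H" "T \<subseteq> H" "card S = q - 1" "card T = q - 1" for S T u v
    proof -
      define red where "red u = (\<lambda>j\<in>{..<q - 1}. u j mod p)" for u :: word
      have red: "red u \<in> W" for u
        using assms by (auto simp: red_def W_def)
      have "agree p (q - 1) u (red u)" for u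
        by (simp add: agree_def red_def)
      then have agr: "agree p N (spread S' u) (spread S' (red u))"
        if "S' \<subseteq> H" "card S' = q - 1" for S' u
        using scaled_map_spread[of S' N "q - 1" p] that H(1) unfolding scaled_map_def by blast
      have "E (spread S' u) (spread S' v) \<longleftrightarrow> (red u, red v) \<in> f S'"
        if "S' \<subseteq> H" "card S' = q - 1" for S'
        using word_colouring_cong[OF E agr[OF that] agr[OF that]] red by (auto simp: f_def)
      then show ?thesis using hom ST by metis
    qed
    have "zero_commutes q (pullback (spread H) E)"
      unfolding zero_commutes_def
    proof (intro allI impI)
      fix x y :: word and i assume i: "Suc i < q" "x i = 0" "y i = 0"
      obtain h h' where h: "h \<in> H" "index_in H h = i" "h' \<in> H" "index_in H h' = Suc i"
        using bij_betw_index_in[OF fin] i(1) H(2)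
        by (metis Suc_lessD bij_betw_imp_surj_on imageE lessThan_iff)
      have c: "card (H - {h}) = q - 1" "card (H - {h'}) = q - 1"
        using h H fin by auto
      have del: "(\<lambda>j. if j < Suc i then swap_at i z j else swap_at i z (Suc j)) =
          (\<lambda>j. if j < i then z j else z (Suc j))" for z
        by (auto simp: swap_at_def fun_eq_iff less_Suc_eq)
      have "spread H z = spread (H - {h}) (\<lambda>j. if j < i then z j else z (Suc j))"
        and "spread H (swap_at i z) = spread (H - {h'}) (\<lambda>j. if j < i then z j else z (Suc j))"
        if "z i = 0" for z
        using spread_remove_zero[OF fin h(1), of z] that
          spread_remove_zero[OF fin h(3), of "swap_at i z"] del[of z] h
        by (auto simp: swap_at_def)
      then show "E (spread H x) (spread H y) = E (spread H (swap_at i x)) (spread H (swap_at i y))"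
        using same[of "H - {h}" "H - {h'}"] c i by auto
    qed
    then show "\<exists>g. scaled_map p 1 q N g \<and> zero_commutes q (pullback g E) \<and>
        (\<forall>s. interchangeable s N E \<longrightarrow> interchangeable s q (pullback g E))"
      using scaled_map_spread[OF H] interchangeable_spread H by blast
  qed
qed

section \<open>Making all common letters interchangeable\<close>

lemma interchangeable_zero:
  assumes "interchangeable s n E" "i < n" "x i = y i" "x i \<le> s"
  shows "E x y = E (x(i := 0)) (y(i := 0))"
proof -
  have "a \<le> s \<Longrightarrow> E (x(i := a)) (y(i := a)) = E (x(i := 0)) (y(i := 0))" for a
  proof (induction a)
    case (Suc a)
    have "E (x(i := a)) (y(i := a)) = E (x(i := Suc a)) (y(i := Suc a))"
      using assms(1)[unfolded interchangeable_def, rule_format, of i "x(i := a)" "y(i := a)"]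
        assms(2) Suc.prems by simp
    moreover have "E (x(i := a)) (y(i := a)) = E (x(i := 0)) (y(i := 0))"
      using Suc.prems by (intro Suc.IH) simp
    ultimately show ?case by argo
  qed simp
  from this[of "x i"] show ?thesis
    using assms(3,4) by (metis fun_upd_triv)
qed

text \<open>
  Replace the common letter by \<open>0\<close>, move the \<open>0\<close>, and change it back.
\<close>

lemma common_letter_commutes:
  assumes int: "interchangeable s n E" and zero: "zero_commutes n E"
    and i: "Suc i < n" "x i = y i" "x i \<le> s"
  shows "E x y = E (swap_at i x) (swap_at i y)"
proof -
  have eq: "swap_at i (z(i := 0)) = (swap_at i z)(Suc i := 0)" for z
    by (auto simp: swap_at_def)
  have "E x y = E (x(i := 0)) (y(i := 0))"
    using interchangeable_zero[OF int, of i x y] i by simp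
  also have "\<dots> = E (swap_at i (x(i := 0))) (swap_at i (y(i := 0)))"
    using zero i unfolding zero_commutes_def by simp
  also have "\<dots> = E (swap_at i x) (swap_at i y)"
    unfolding eq using interchangeable_zero[OF int, of "Suc i" "swap_at i x" "swap_at i y"] i
    by (simp add: swap_at_def)
  finally show ?thesis .
qed

text \<open>
  The letter at \<open>b\<close> is moved \<open>r\<close> places to the right; the letters that it passes move left.
\<close>

definition rot :: "nat \<Rightarrow> nat \<Rightarrow> word \<Rightarrow> word" where
  "rot b r x k = (if b \<le> k \<and> k < b + r then x (Suc k) else if k = b + r then x b else x k)"

lemma rot_0: "rot b 0 x = x"
  by (auto simp: rot_def)

lemma rot_Suc: "rot b (Suc r) x = swap_at (b + r) (rot b r x)"
  by (auto simp: rot_def swap_at_def fun_eq_iff)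

lemma common_letter_rot:
  assumes "interchangeable s n E" "zero_commutes n E" "b + r < n" "x b = y b" "x b \<le> s"
  shows "E x y = E (rot b r x) (rot b r y)"
  using assms(3)
proof (induction r)
  case (Suc r)
  have "E (rot b r x) (rot b r y) = E (rot b (Suc r) x) (rot b (Suc r) y)"
    unfolding rot_Suc using Suc.prems assms
    by (intro common_letter_commutes) (auto simp: rot_def)
  with Suc show ?case by simp
qed (simp add: rot_0)

definition blocks :: "nat \<Rightarrow> word \<Rightarrow> word" where
  "blocks p x k = x (k div p) + k mod p"

lemma scaled_map_blocks:
  assumes "p > 0"
  shows "scaled_map p p m (m * p) (blocks p)"
proof -
  have "agree p (m * p) (blocks p x) (blocks p y)" if "agree p m x y" for x y
    using that by (auto simp: agree_def blocks_def less_mult_imp_div_less intro: mod_add_cong)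
  moreover have "(\<Sum>i<m * p. D (blocks p x i) (blocks p y i)) = real p * (\<Sum>j<m. D (x j) (y j))"
    if D: "\<forall>a b r. D (a + r) (b + r) = D a b" for D :: "nat \<Rightarrow> nat \<Rightarrow> real" and x y
  proof -
    have "(\<Sum>i<m * p. D (blocks p x i) (blocks p y i)) =
        (\<Sum>j<m. \<Sum>i\<in>{j * p..<j * p + p}. D (blocks p x i) (blocks p y i))"
      by (rule sum.nat_group[symmetric])
    also have "\<dots> = (\<Sum>j<m. \<Sum>i\<in>{j * p..<j * p + p}. D (x j) (y j))"
    proof (intro sum.cong refl)
      fix j i assume "i \<in> {j * p..<j * p + p}"
      then have "i div p = j"
        by (auto intro!: div_nat_eqI simp: mult.commute)
      then show "D (blocks p x i) (blocks p y i) = D (x j) (y j)"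
        using D by (simp add: blocks_def)
    qed
    finally show ?thesis by (simp add: sum_distrib_left)
  qed
  ultimately show ?thesis by (simp add: scaled_map_def)
qed

text \<open>
  The point of the construction: increasing a letter amounts to rotating its block, up to the
  identification of \<open>x j + p\<close> with \<open>x j\<close> at the end of the block.
\<close>

lemma rot_blocks:
  assumes "p > 0"
  shows "agree p n (rot (j * p) (p - 1) (blocks p x)) (blocks p (x(j := Suc (x j))))"
  unfolding agree_def
proof (intro allI impI)
  fix k
  show "rot (j * p) (p - 1) (blocks p x) k mod p = blocks p (x(j := Suc (x j))) k mod p"
  proof (cases "k div p = j")
    case True
    then have k: "k = j * p + k mod p" by (metis div_mult_mod_eq)
    define t where "t = k mod p"
    have kt: "k = j * p + t" "t < p" using k assms by (auto simp: t_def)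
    show ?thesis
    proof (cases "Suc t < p")
      case True
      then have "Suc k div p = j" "Suc k mod p = Suc t"
        using kt by (auto intro!: div_nat_eqI simp: mod_nat_eqI)
      with True kt assms show ?thesis by (auto simp: rot_def blocks_def)
    next
      case False
      then have t: "p - 1 = t" "Suc (x j) + t = x j + p" using kt by simp_all
      have "Suc (x j + t) mod p = x j mod p"
        using t(2) by (metis add_Suc mod_add_self2)
      then show ?thesis using kt t(1) by (simp add: rot_def blocks_def)
    qed
  next
    case False
    then have "\<not> (j * p \<le> k \<and> k < j * p + p)"
      by (metis add.commute div_nat_eqI mult.commute mult_Suc_right)
    then have "\<not> (j * p \<le> k \<and> k < j * p + (p - 1))" "k \<noteq> j * p + (p - 1)"
      using assms by auto
    with False show ?thesis by (auto simp: rot_def blocks_def)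
  qed
qed

text \<open>
  If two words of blocks share the block of a letter \<open>a \<le> s\<close>, then they share its first letter \<open>a\<close>,
  and moving this letter to the end of the block in both words turns \<open>a\<close> into \<open>a + 1\<close>.
\<close>

lemma interchangeable_blocks:
  assumes "p > 0" and E: "word_colouring p (m * p) E"
    and int: "interchangeable s (m * p) E" and zero: "zero_commutes (m * p) E"
  shows "interchangeable (Suc s) m (pullback (blocks p) E)"
  unfolding interchangeable_def
proof (intro allI impI)
  fix x y :: word and j assume j: "j < m" "x j = y j" "x j < Suc s"
  have "j * p + p \<le> m * p"
    using j(1) by (metis Suc_leI add.commute mult_Suc mult_le_mono1)
  then have "E (blocks p x) (blocks p y) =
      E (rot (j * p) (p - 1) (blocks p x)) (rot (j * p) (p - 1) (blocks p y))"
    using assms(1) j by (intro common_letter_rot[OF int zero]) (auto simp: blocks_def)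
  also have "\<dots> = E (blocks p (x(j := Suc (x j)))) (blocks p (y(j := Suc (y j))))"
    using word_colouring_cong[OF E rot_blocks rot_blocks] assms(1) by blast
  finally show "E (blocks p x) (blocks p y) =
      E (blocks p (x(j := Suc (x j)))) (blocks p (y(j := Suc (y j))))" .
qed

lemma interchangeable_subspace:
  assumes "p > 0"
  shows "\<exists>n. \<forall>E. word_colouring p n E \<longrightarrow>
     (\<exists>g. scaled_map p (p ^ s) m n g \<and> interchangeable s m (pullback g E))"
proof (induction s arbitrary: m)
  case 0
  have "scaled_map p (p ^ 0) m m (\<lambda>x. x)" "interchangeable 0 m (pullback (\<lambda>x. x) E)" for E
    using scaled_map_id by (simp_all add: interchangeable_def)
  then show ?case by blast
next
  case (Suc s)
  obtain N where N: "\<And>E. word_colouring p N E \<Longrightarrow>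
     \<exists>g. scaled_map p 1 (m * p) N g \<and> zero_commutes (m * p) (pullback g E) \<and>
        (\<forall>s. interchangeable s N E \<longrightarrow> interchangeable s (m * p) (pullback g E))"
    using ramsey_zero_commutes[OF assms, of "m * p"] by blast
  obtain n where n: "\<And>E. word_colouring p n E \<Longrightarrow>
     \<exists>g. scaled_map p (p ^ s) N n g \<and> interchangeable s N (pullback g E)"
    using Suc by blast
  show ?case
  proof (intro exI[of _ n] allI impI)
    fix E assume E: "word_colouring p n E"
    then obtain f where f: "scaled_map p (p ^ s) N n f" "interchangeable s N (pullback f E)"
      using n by blast
    obtain h where h: "scaled_map p 1 (m * p) N h"
      "zero_commutes (m * p) (pullback h (pullback f E))"
      "interchangeable s (m * p) (pullback h (pullback f E))"
      using N[OF word_colouring_pullback[OF E f(1)]] f(2) by blast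
    have "interchangeable (Suc s) m (pullback (blocks p) (pullback h (pullback f E)))"
      using interchangeable_blocks[OF assms _ h(3,2)]
        word_colouring_pullback[OF word_colouring_pullback[OF E f(1)] h(1)] by blast
    moreover have "scaled_map p (p ^ Suc s) m n (\<lambda>x. f (h (blocks p x)))"
      using scaled_map_comp[OF scaled_map_comp[OF scaled_map_blocks[OF assms] h(1)] f(1)] by simp
    ultimately show "\<exists>g. scaled_map p (p ^ Suc s) m n g \<and> interchangeable (Suc s) m (pullback g E)"
      by blast
  qed
qed

section \<open>Exchanging adjacent letters\<close>

text \<open>
  Modulo \<open>p\<close> the bound \<open>p - 1\<close> already covers every letter; allowing arbitrary representatives
  afterwards removes the bound from all later statements.
\<close>

lemma interchangeable_all:
  assumes E: "word_colouring p n E" and "p > 0" and int: "interchangeable (p - 1) n E"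
  shows "interchangeable s n E"
  unfolding interchangeable_def
proof (intro allI impI)
  fix x y :: word and i assume i: "i < n" "x i = y i"
  define a where "a = x i"
  have red: "E (x(i := b)) (y(i := b)) = E (x(i := c)) (y(i := c))" if "b mod p = c mod p" for b c
    using that by (intro word_colouring_cong[OF E]) (auto simp: agree_def)
  have "E (x(i := a)) (y(i := a)) = E (x(i := a mod p)) (y(i := a mod p))"
    by (rule red) simp
  also have "\<dots> = E (x(i := 0)) (y(i := 0))"
    using interchangeable_zero[OF int, of i "x(i := a mod p)" "y(i := a mod p)"] i assms(2)
    by (simp add: less_Suc_eq_le[symmetric])
  also have "\<dots> = E (x(i := Suc a mod p)) (y(i := Suc a mod p))"
    using interchangeable_zero[OF int, of i "x(i := Suc a mod p)" "y(i := Suc a mod p)"] i assms(2)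
    by (simp add: less_Suc_eq_le[symmetric])
  also have "\<dots> = E (x(i := Suc a)) (y(i := Suc a))"
    by (rule red) simp
  finally show "E x y = E (x(i := Suc (x i))) (y(i := Suc (y i)))"
    using i(2) by (metis a_def fun_upd_triv)
qed

lemma interchangeable_set:
  assumes int: "\<And>s. interchangeable s n E" and i: "i < n" "x i = y i"
  shows "E x y = E (x(i := c)) (y(i := c))"
proof -
  have "E x y = E (x(i := 0)) (y(i := 0))"
    using interchangeable_zero[OF int, of i x y "x i"] i by simp
  also have "\<dots> = E (x(i := c)) (y(i := c))"
    using interchangeable_zero[OF int, of i "x(i := c)" "y(i := c)" c] i by simp
  finally show ?thesis .
qed

lemma interchangeable_override:
  assumes int: "\<And>s. interchangeable s n E" and A: "finite A" "A \<subseteq> {..<n}" "\<And>k. k \<in> A \<Longrightarrow> x k = y k"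
  shows "E x y = E (override_on x z A) (override_on y z A)"
  using A
proof (induction A)
  case (insert k A)
  have "E x y = E (override_on x z A) (override_on y z A)"
    using insert by auto
  also have "\<dots> = E ((override_on x z A)(k := z k)) ((override_on y z A)(k := z k))"
    using insert by (intro interchangeable_set[OF int]) (auto simp: override_on_def)
  finally show ?case
    unfolding override_on_insert .
qed simp

text \<open>
  The relation \<open>a \<approx> b\<close> of the introduction, in the context of the zero word; the next two lemmas show
  that neither the context nor the position \<open>i\<close> matters.
\<close>

definition exchange :: "(word \<Rightarrow> word \<Rightarrow> bool) \<Rightarrow> nat \<Rightarrow> nat \<Rightarrow> nat \<Rightarrow> bool" where
  "exchange E i a b \<longleftrightarrow> E ((\<lambda>_. 0)(i := a, Suc i := b)) ((\<lambda>_. 0)(i := b, Suc i := a))"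

lemma exchange_context:
  assumes E: "word_colouring p n E" and int: "\<And>s. interchangeable s n E" and i: "Suc i < n"
  shows "E (x(i := a, Suc i := b)) (x(i := b, Suc i := a)) = exchange E i a b"
proof -
  let ?A = "{..<n} - {i, Suc i}" and ?u = "x(i := a, Suc i := b)" and ?v = "x(i := b, Suc i := a)"
  have "E ?u ?v = E (override_on ?u (\<lambda>_. 0) ?A) (override_on ?v (\<lambda>_. 0) ?A)"
    by (rule interchangeable_override[OF int]) auto
  also have "\<dots> = exchange E i a b"
    unfolding exchange_def
    by (rule word_colouring_cong[OF E]) (auto simp: agree_def override_on_def)
  finally show ?thesis .
qed

text \<open>
  The pairs \<open>(0ab, 0ba)\<close>, \<open>(a0b, b0a)\<close>, \<open>(ab0, ba0)\<close> arise from each other by moving a common \<open>0\<close>.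
\<close>

lemma exchange_position:
  assumes zero: "zero_commutes n E" and i: "Suc i < n"
  shows "exchange E i a b = exchange E 0 a b"
  using i
proof (induction i)
  case (Suc i)
  let ?x = "(\<lambda>_. 0 :: nat)(Suc i := a, Suc (Suc i) := b)"
    and ?y = "(\<lambda>_. 0 :: nat)(Suc i := b, Suc (Suc i) := a)"
  have "E ?x ?y = E (swap_at i ?x) (swap_at i ?y)"
    using zero Suc.prems unfolding zero_commutes_def by simp
  also have "\<dots> = E (swap_at (Suc i) (swap_at i ?x)) (swap_at (Suc i) (swap_at i ?y))"
    by (rule zero[unfolded zero_commutes_def, rule_format])
      (use Suc.prems in \<open>simp_all add: swap_at_def\<close>)
  also have "swap_at (Suc i) (swap_at i ?x) = (\<lambda>_. 0)(i := a, Suc i := b)"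
    by (auto simp: swap_at_def fun_eq_iff)
  also have "swap_at (Suc i) (swap_at i ?y) = (\<lambda>_. 0)(i := b, Suc i := a)"
    by (auto simp: swap_at_def fun_eq_iff)
  finally have "exchange E (Suc i) a b = exchange E i a b"
    unfolding exchange_def .
  with Suc show ?case by simp
qed simp

text \<open>
  With a third coordinate holding \<open>b\<close>, the letters \<open>a\<close> and \<open>c\<close> can be exchanged through
  \<open>acb, bca, cba, cab\<close>. The first of these steps exchanges letters that are not adjacent; the common
  letter \<open>c\<close> between them is moved out of the way.
\<close>

lemma exchange_trans:
  assumes E: "word_colouring p n E" and int: "\<And>s. interchangeable s n E"
    and zero: "zero_commutes n E" and n: "n \<ge> 3"
    and ab: "exchange E 0 a b" and bc: "exchange E 0 b c"
  shows "exchange E 0 a c"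
proof -
  define w where "w u v t = (\<lambda>_. 0 :: nat)(0 := u, Suc 0 := v, Suc (Suc 0) := t)" for u v t :: nat
  have sw0: "swap_at 0 (w u v t) = w v u t" for u v t
    by (auto simp: w_def swap_at_def fun_eq_iff)
  have ex0: "E (w u v t) (w v u t) = exchange E 0 u v" for u v t
    using exchange_context[OF E int, of 0 "(\<lambda>_. 0)(Suc (Suc 0) := t)" u v] n
    by (simp add: w_def fun_upd_twist)
  have ex1: "E (w t u v) (w t v u) = exchange E 0 u v" for u v t
    using exchange_context[OF E int, of "Suc 0" "(\<lambda>_. 0)(0 := t)" u v] n
      exchange_position[OF zero, of "Suc 0"]
    by (simp add: w_def)
  have "E (w a c b) (w b c a) = E (w c a b) (w c b a)"
    using common_letter_commutes[OF int zero, of 0 "w c a b" "w c b a" c] n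
    by (simp add: sw0) (simp add: w_def)
  then have "E (w a c b) (w b c a)" using ab ex1 by simp
  moreover have "E (w b c a) (w c b a)" using bc ex0 by simp
  moreover have "E (w c b a) (w c a b)"
    using ab ex1 word_colouring_sym[OF E] by metis
  ultimately have "E (w a c b) (w c a b)"
    using word_colouring_trans[OF E] by blast
  then show ?thesis using ex0 by simp
qed

lemma rot_monochromatic:
  assumes E: "word_colouring p n E" and int: "\<And>s. interchangeable s n E"
    and zero: "zero_commutes n E" and ex: "\<And>a b. exchange E 0 a b" and "b + r < n"
  shows "E x (rot b r x)"
  using assms(5)
proof (induction r)
  case 0
  then show ?case using word_colouring_refl[OF E] by (simp add: rot_0)
next
  case (Suc r)
  let ?z = "rot b r x" and ?i = "b + r"
  have "E (?z(?i := ?z ?i, Suc ?i := ?z (Suc ?i))) (?z(?i := ?z (Suc ?i), Suc ?i := ?z ?i))"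
    unfolding exchange_context[OF E int Suc.prems[unfolded add_Suc_right]]
      exchange_position[OF zero Suc.prems[unfolded add_Suc_right]]
    by (rule ex)
  then have "E ?z (swap_at ?i ?z)"
    by (simp add: swap_at_def)
  moreover have "E x ?z"
    using Suc by simp
  ultimately show ?case
    unfolding rot_Suc by (rule word_colouring_trans[OF E, rotated])
qed

section \<open>The dichotomy for words of blocks\<close>

text \<open>
  An additional coordinate that holds the common letter \<open>0\<close> in all words under consideration serves
  as a spare letter, see \<open>exchange_if_same_colour\<close>.
\<close>

definition cons_zero :: "word \<Rightarrow> word" where
  "cons_zero x = case_nat 0 x"

lemma cons_zero_simps [simp]: "cons_zero x 0 = 0" "cons_zero x (Suc k) = x k"
  by (simp_all add: cons_zero_def)

lemma agree_cons_zero: "agree p n x y \<Longrightarrow> agree p (Suc n) (cons_zero x) (cons_zero y)"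
  by (auto simp: agree_def less_Suc_eq_0_disj)

lemma scaled_map_cons_zero: "scaled_map p 1 n (Suc n) cons_zero"
  unfolding scaled_map_def by (simp add: agree_cons_zero sum.lessThan_Suc_shift del: sum.lessThan_Suc)

lemma rot_cons_zero: "rot (Suc b) r (cons_zero x) = cons_zero (rot b r x)"
proof
  fix k
  show "rot (Suc b) r (cons_zero x) k = cons_zero (rot b r x) k"
    by (cases k) (auto simp: rot_def)
qed

text \<open>
  If all exchanges preserve colours, so do all rotations of blocks, hence all changes of letters of \<open>x\<close>;
  so every word has the colour of the word of blocks of zeros.
\<close>

lemma monochromatic_blocks:
  assumes p: "p > 0" and E: "word_colouring p (Suc (m * p)) E"
    and int: "\<And>s. interchangeable s (Suc (m * p)) E" and zero: "zero_commutes (Suc (m * p)) E"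
    and ex: "\<And>a b. exchange E 0 a b"
  shows "E (cons_zero (blocks p x)) (cons_zero (blocks p y))"
proof -
  define F where "F = pullback (\<lambda>x. cons_zero (blocks p x)) E"
  have F: "word_colouring p m F"
    unfolding F_def
    by (rule word_colouring_pullback[OF E scaled_map_comp[OF scaled_map_blocks[OF p] scaled_map_cons_zero]])
  have step: "F x (x(j := Suc (x j)))" if "j < m" for x j
  proof -
    have "j * p + p \<le> m * p"
      using that by (metis Suc_leI add.commute mult_Suc mult_le_mono1)
    then have "E (cons_zero (blocks p x)) (rot (Suc (j * p)) (p - 1) (cons_zero (blocks p x)))"
      using p by (intro rot_monochromatic[OF E int zero ex]) auto
    moreover have "E (rot (Suc (j * p)) (p - 1) (cons_zero (blocks p x)))
        (cons_zero (blocks p (x(j := Suc (x j)))))"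
      unfolding rot_cons_zero using p
      by (intro word_colouring_agree[OF E] agree_cons_zero rot_blocks)
    ultimately show ?thesis
      unfolding F_def using word_colouring_trans[OF E] by blast
  qed
  have letter: "F (x(j := 0)) (x(j := a))" if "j < m" for x j a
  proof (induction a)
    case (Suc a)
    have "F (x(j := a)) (x(j := Suc a))"
      using step[OF that, of "x(j := a)"] by simp
    with Suc show ?case
      by (rule word_colouring_trans[OF F])
  qed (rule word_colouring_refl[OF F])
  have zeroing: "F x (override_on x (\<lambda>_. 0) A)" if "finite A" "A \<subseteq> {..<m}" for x A
    using that
  proof (induction A)
    case (insert k A)
    let ?z = "override_on x (\<lambda>_. 0) A"
    have "F (?z(k := 0)) (?z(k := ?z k))"
      using insert by (intro letter) auto
    then have "F ?z (?z(k := 0))"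
      using word_colouring_sym[OF F] by simp
    moreover have "F x ?z"
      using insert by simp
    ultimately show ?case
      unfolding override_on_insert by (rule word_colouring_trans[OF F, rotated])
  qed (simp add: word_colouring_refl[OF F])
  have "F x (\<lambda>_. 0)" for x
  proof -
    have "F (override_on x (\<lambda>_. 0) {..<m}) (\<lambda>_. 0)"
      by (rule word_colouring_agree[OF F]) (simp add: agree_def)
    moreover have "F x (override_on x (\<lambda>_. 0) {..<m})"
      by (rule zeroing) auto
    ultimately show ?thesis
      by (rule word_colouring_trans[OF F, rotated])
  qed
  then have "F x (\<lambda>_. 0)" "F (\<lambda>_. 0) y"
    by (blast intro: word_colouring_sym[OF F])+
  then have "F x y"
    by (rule word_colouring_trans[OF F])
  then show ?thesis by (simp add: F_def)
qed

text \<open>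
  Let \<open>a\<close> and \<open>b\<close> be the letters of \<open>x\<close> and \<open>y\<close> at \<open>k\<close>. Put the spare common letter next to them and
  change it to \<open>b\<close>: if it is on the left, then \<open>x\<close> with \<open>ba\<close> has the colour of \<open>y\<close> with \<open>bb\<close>; if it
  is on the right, then \<open>x\<close> with \<open>ab\<close> has the colour of the same word \<open>y\<close> with \<open>bb\<close>. Hence \<open>x\<close> with
  \<open>ba\<close> and \<open>x\<close> with \<open>ab\<close> have equal colours, and they differ by one exchange.
\<close>

lemma exchange_if_same_colour:
  assumes E: "word_colouring p (Suc n) E" and int: "\<And>s. interchangeable s (Suc n) E"
    and zero: "zero_commutes (Suc n) E"
    and same: "E (cons_zero x) (cons_zero y)" and k: "k < n"
  shows "exchange E 0 (x k) (y k)"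
proof -
  define u where "u = rot 0 k (cons_zero x)"
  define v where "v = rot 0 k (cons_zero y)"
  have uv: "u k = 0" "u (Suc k) = x k" "v k = 0" "v (Suc k) = y k"
    by (simp_all add: u_def v_def rot_def)
  have "E u v"
    unfolding u_def v_def using same k common_letter_rot[OF int zero, of 0 k "cons_zero x" "cons_zero y" 0]
    by simp
  then have "E (swap_at k u) (swap_at k v)"
    using zero k uv unfolding zero_commutes_def by simp
  then have "E ((swap_at k u)(Suc k := y k)) ((swap_at k v)(Suc k := y k))"
    using interchangeable_set[OF int, of "Suc k" "swap_at k u" "swap_at k v" "y k"] k uv
    by (simp add: swap_at_def)
  moreover have "(swap_at k u)(Suc k := y k) = u(k := x k, Suc k := y k)"
    "(swap_at k v)(Suc k := y k) = v(k := y k)"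
    using uv by (auto simp: swap_at_def fun_eq_iff)
  moreover have "E (u(k := y k)) (v(k := y k))"
    using interchangeable_set[OF int, of k u v "y k"] k uv \<open>E u v\<close> by simp
  moreover have "u(k := y k) = u(k := y k, Suc k := x k)"
    using uv by (auto simp: fun_eq_iff)
  ultimately have "E (u(k := x k, Suc k := y k)) (u(k := y k, Suc k := x k))"
    using word_colouring_trans[OF E] word_colouring_sym[OF E] by metis
  then show ?thesis
    using exchange_context[OF E int, of k u] exchange_position[OF zero, of k] k by simp
qed

text \<open>
  The hypothesis says that \<open>u\<close> is related to \<open>u + d\<close> for all \<open>u\<close>, where \<open>d\<close> is \<open>b - a\<close> modulo \<open>p\<close>;
  every residue is a multiple of \<open>d\<close> as \<open>d\<close> is invertible.
\<close>

lemma translation_closed_total: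
  fixes S :: "nat \<Rightarrow> nat \<Rightarrow> bool"
  assumes p: "prime p" and refl: "\<And>u v. u mod p = v mod p \<Longrightarrow> S u v"
    and trans: "\<And>u v w. S u v \<Longrightarrow> S v w \<Longrightarrow> S u w"
    and ab: "a mod p \<noteq> b mod p" and S: "\<And>r. r < p \<Longrightarrow> S (a + r) (b + r)"
  shows "S u v"
proof -
  have p0: "p > 0" using p prime_gt_0_nat by blast
  \<comment> \<open>\<open>b - a\<close> modulo \<open>p\<close>, without truncated subtraction\<close>
  define d where "d = b + (p - a mod p)"
  have ad: "(a + d) mod p = b mod p"
  proof -
    have "(a + d) mod p = (a mod p + d) mod p" by (simp add: mod_simps)
    also have "a mod p + d = b + p"
      using mod_less_divisor[OF p0, of a] by (simp add: d_def)
    finally show ?thesis by simp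
  qed
  have shift: "S u (u + d)" for u
  proof -
    \<comment> \<open>the residue of \<open>u - a\<close>\<close>
    define r where "r = (u + (p - a mod p)) mod p"
    have r: "(a + r) mod p = u mod p"
    proof -
      have "(a + r) mod p = (a mod p + (u + (p - a mod p))) mod p"
        unfolding r_def by (simp add: mod_simps)
      also have "a mod p + (u + (p - a mod p)) = u + p"
        using mod_less_divisor[OF p0, of a] by simp
      finally show ?thesis by simp
    qed
    have "(b + r) mod p = (b mod p + r) mod p" by (simp add: mod_simps)
    also have "\<dots> = ((a + d) mod p + r) mod p" using ad by simp
    also have "\<dots> = ((a + r) mod p + d) mod p" by (simp add: mod_simps ac_simps)
    also have "\<dots> = (u + d) mod p" unfolding r by (simp add: mod_simps)
    finally have "S (b + r) (u + d)" by (rule refl)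
    moreover have "S u (a + r)" using r by (intro refl) simp
    moreover have "S (a + r) (b + r)" using p0 by (intro S) (simp add: r_def)
    ultimately show ?thesis using trans by blast
  qed
  have multiples: "S u (u + t * d)" for u t
  proof (induction t)
    case (Suc t)
    have "S u (u + t * d + d)"
      using Suc shift by (rule trans)
    then show ?case by (simp add: ac_simps)
  qed (simp add: refl)
  have "\<not> p dvd d"
  proof
    assume "p dvd d"
    then have "(a + d) mod p = a mod p" by (auto elim!: dvdE)
    with ad ab show False by simp
  qed
  then have "coprime d p" using p by (metis coprime_commute prime_imp_coprime)
  then obtain e where e: "[d * e = 1] (mod p)"
    using cong_solve_coprime_nat by (metis One_nat_def)
  define c where "c = v + (p - u mod p)"
  have "[d * e * c = 1 * c] (mod p)"
    using e by (rule cong_scalar_right)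
  then have "[u + e * c * d = u + c] (mod p)"
    by (intro cong_add cong_refl) (simp add: ac_simps)
  moreover have "[u + c = v] (mod p)"
  proof -
    have "(u + c) mod p = (u mod p + c) mod p" by (simp add: mod_simps)
    also have "u mod p + c = v + p"
      using mod_less_divisor[OF p0, of u] by (simp add: c_def)
    finally show ?thesis by (simp add: cong_def)
  qed
  ultimately have "S (u + e * c * d) v"
    using cong_trans by (intro refl) (auto simp: cong_def)
  with multiples[of u "e * c"] show ?thesis using trans by blast
qed

text \<open>
  The combinatorial core. The factor \<open>p\<^sup>p\<close> consists of \<open>p\<^bsup>p - 1\<^esup>\<close> for making the common letters
  interchangeable and \<open>p\<close> for the final blocks.
\<close>

theorem canonical_ramsey_words:
  assumes p: "prime p" and m: "m > 0"
  shows "\<exists>n. \<forall>E. word_colouring p n E \<longrightarrow>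
     (\<exists>g. scaled_map p (p ^ p) m n g \<and>
        ((\<forall>x y. E (g x) (g y)) \<or> (\<forall>x y. E (g x) (g y) \<longrightarrow> agree p m x y)))"
proof -
  have p2: "p \<ge> 2" and p0: "p > 0" using p prime_ge_2_nat prime_gt_0_nat by blast+
  define q where "q = Suc (m * p)"
  have q3: "q \<ge> 3"
    using mult_le_mono[of 1 m 2 p] m p2 by (simp add: q_def)
  obtain N where N: "\<And>E. word_colouring p N E \<Longrightarrow>
     \<exists>g. scaled_map p 1 q N g \<and> zero_commutes q (pullback g E) \<and>
        (\<forall>s. interchangeable s N E \<longrightarrow> interchangeable s q (pullback g E))"
    using ramsey_zero_commutes[OF p0, of q] by blast
  obtain n where n: "\<And>E. word_colouring p n E \<Longrightarrow>
     \<exists>g. scaled_map p (p ^ (p - 1)) N n g \<and> interchangeable (p - 1) N (pullback g E)"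
    using interchangeable_subspace[OF p0, of "p - 1" N] by blast
  show ?thesis
  proof (intro exI[of _ n] allI impI)
    fix E assume E: "word_colouring p n E"
    then obtain f where f: "scaled_map p (p ^ (p - 1)) N n f"
      "interchangeable (p - 1) N (pullback f E)"
      using n by blast
    obtain h where h: "scaled_map p 1 q N h"
      "zero_commutes q (pullback h (pullback f E))"
      "interchangeable (p - 1) q (pullback h (pullback f E))"
      using N[OF word_colouring_pullback[OF E f(1)]] f(2) by blast
    define F where "F = pullback h (pullback f E)"
    have F: "word_colouring p (Suc (m * p)) F"
      using word_colouring_pullback[OF word_colouring_pullback[OF E f(1)] h(1)]
      by (simp add: F_def q_def)
    have zero: "zero_commutes (Suc (m * p)) F"
      using h(2) by (simp add: F_def q_def)
    have int: "interchangeable s (Suc (m * p)) F" for s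
      using interchangeable_all[OF F p0] h(3) by (simp add: F_def q_def)
    define g where "g x = f (h (cons_zero (blocks p x)))" for x
    have "scaled_map p (p * 1 * 1 * p ^ (p - 1)) m n g"
      unfolding g_def
      by (rule scaled_map_comp[OF scaled_map_comp[OF scaled_map_comp[OF scaled_map_blocks[OF p0]
              scaled_map_cons_zero] h(1)[unfolded q_def]] f(1)])
    then have g: "scaled_map p (p ^ p) m n g"
      using p0 by (simp add: power_eq_if)
    have Eg: "E (g x) (g y) = F (cons_zero (blocks p x)) (cons_zero (blocks p y))" for x y
      by (simp add: F_def g_def)
    show "\<exists>g. scaled_map p (p ^ p) m n g \<and>
        ((\<forall>x y. E (g x) (g y)) \<or> (\<forall>x y. E (g x) (g y) \<longrightarrow> agree p m x y))"
    proof (cases "\<forall>a b. exchange F 0 a b")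
      case True
      then have "E (g x) (g y)" for x y
        unfolding Eg by (intro monochromatic_blocks[OF p0 F int zero]) blast
      with g show ?thesis by blast
    next
      case False
      have "agree p m x y" if "E (g x) (g y)" for x y
      proof (rule ccontr)
        assume "\<not> agree p m x y"
        then obtain j where j: "j < m" "x j mod p \<noteq> y j mod p"
          by (auto simp: agree_def)
        have ex: "exchange F 0 (x j + r) (y j + r)" if "r < p" for r
        proof -
          have "j * p + p \<le> m * p"
            using j(1) by (metis Suc_leI add.commute mult_Suc mult_le_mono1)
          then have "exchange F 0 (blocks p x (j * p + r)) (blocks p y (j * p + r))"
            using that \<open>E (g x) (g y)\<close> unfolding Eg
            by (intro exchange_if_same_colour[OF F int zero]) auto
          with that show ?thesis by (simp add: blocks_def)
        qed
        have "exchange F 0 a b" for a b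
        proof (rule translation_closed_total[where S = "exchange F 0", OF p _ _ j(2) ex])
          show "exchange F 0 u v" if "u mod p = v mod p" for u v
            unfolding exchange_def using that
            by (intro word_colouring_agree[OF F]) (auto simp: agree_def)
          show "exchange F 0 u w" if "exchange F 0 u v" "exchange F 0 v w" for u v w
            using exchange_trans[OF F int zero] q3 that by (simp add: q_def)
        qed
        with False show False by blast
      qed
      with g show ?thesis by blast
    qed
  qed
qed

section \<open>Regular polygons\<close>

lemma dist_circle:
  fixes a :: "real^2"
  shows "(dist (a + r *\<^sub>R vector [cos u, sin u]) (a + r *\<^sub>R vector [cos v, sin v]))\<^sup>2 =
    r\<^sup>2 * (2 - 2 * cos (u - v))"
proof -
  have "(dist (a + r *\<^sub>R vector [cos u, sin u]) (a + r *\<^sub>R vector [cos v, sin v]))\<^sup>2 =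
      r\<^sup>2 * ((cos u - cos v)\<^sup>2 + (sin u - sin v)\<^sup>2)"
    by (simp add: dist_norm norm_vec_def L2_set_def sum_2 power_mult_distrib
        flip: right_diff_distrib distrib_left)
  also have "(cos u - cos v)\<^sup>2 + (sin u - sin v)\<^sup>2 =
      (sin u)\<^sup>2 + (cos u)\<^sup>2 + ((sin v)\<^sup>2 + (cos v)\<^sup>2) - 2 * (cos u * cos v + sin u * sin v)"
    by (simp add: power2_diff algebra_simps)
  finally show ?thesis by (simp add: cos_diff)
qed

lemma regular_polygon_vertices:
  assumes "p > 0" and "regular_polygon p C"
  obtains P :: "nat \<Rightarrow> real^2" where "C = P ` {..<p}" "\<And>a b. a mod p = b mod p \<Longrightarrow> P a = P b"
    "\<And>a b r. dist (P (a + r)) (P (b + r)) = dist (P a) (P b)"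
proof -
  obtain c r \<theta> where C: "C = (\<lambda>j. c + r *\<^sub>R vector [cos (\<theta> + 2 * pi * real j / real p),
                                   sin (\<theta> + 2 * pi * real j / real p)]) ` {..<p}"
    using assms(2) unfolding regular_polygon_def by blast
  define t where "t j = \<theta> + 2 * pi * real j / real p" for j
  define P :: "nat \<Rightarrow> real^2" where "P j = c + r *\<^sub>R vector [cos (t j), sin (t j)]" for j
  have period: "P (a mod p) = P a" for a
  proof -
    have "real a = real (p * (a div p) + a mod p)" by simp
    then have "real a = real p * real (a div p) + real (a mod p)"
      by (simp only: of_nat_add of_nat_mult)
    then have "t a = t (a mod p) + 2 * real (a div p) * pi"
      using assms(1) by (simp add: t_def field_simps)
    then show ?thesis
      by (simp add: P_def sin_add cos_add)
  qed
  have "(dist (P (a + s)) (P (b + s)))\<^sup>2 = (dist (P a) (P b))\<^sup>2" for a b s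
  proof -
    have "t (a + s) - t (b + s) = t a - t b"
      by (simp add: t_def add_divide_distrib ring_distribs)
    then show ?thesis unfolding P_def dist_circle by simp
  qed
  then have "dist (P (a + s)) (P (b + s)) = dist (P a) (P b)" for a b s
    by (metis power2_eq_iff_nonneg zero_le_dist)
  moreover have "P a = P b" if "a mod p = b mod p" for a b
    using period that by metis
  moreover have "C = P ` {..<p}"
    unfolding C P_def t_def by simp
  ultimately show thesis using that by blast
qed

theorem theorem2:
  fixes p k :: nat and C :: "(real^2) set"
  assumes "prime p" and "k > 0" and "regular_polygon p C"
  shows "\<exists>n>0. \<forall>R. colouring (dilate n (real p powr (- real p / 2)) (cart_pow C n)) R \<longrightarrow>
           (\<exists>X. copy_in k (cart_pow C k) n (dilate n (real p powr (- real p / 2)) (cart_pow C n)) X \<and>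
                (monochromatic R X \<or> rainbow R X))"
proof -
  have p0: "p > 0" using assms(1) prime_gt_0_nat by blast
  obtain P :: "nat \<Rightarrow> real^2" where P: "C = P ` {..<p}" "\<And>a b. a mod p = b mod p \<Longrightarrow> P a = P b"
    "\<And>a b r. dist (P (a + r)) (P (b + r)) = dist (P a) (P b)"
    using regular_polygon_vertices[OF p0 assms(3)] by blast
  have PC: "P a \<in> C" for a
    using P(1) P(2)[of a "a mod p"] p0 by auto
  obtain n where n: "\<And>E. word_colouring p n E \<Longrightarrow>
     \<exists>g. scaled_map p (p ^ p) k n g \<and>
        ((\<forall>x y. E (g x) (g y)) \<or> (\<forall>x y. E (g x) (g y) \<longrightarrow> agree p k x y))"
    using canonical_ramsey_words[OF assms(1,2)] by blast
  have "n > 0"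
  proof (rule ccontr)
    assume "\<not> n > 0"
    \<comment> \<open>for \<open>n = 0\<close> all distances would vanish, but the map multiplies them by \<open>p\<^sup>p\<close>\<close>
    have "word_colouring p n (\<lambda>_ _. True)"
      by (auto simp: word_colouring_def intro!: equivpI reflpI sympI transpI)
    then obtain g where g: "scaled_map p (p ^ p) k n g" using n by blast
    define D :: "nat \<Rightarrow> nat \<Rightarrow> real" where "D a b = (if a = b then 0 else 1)" for a b
    have "(\<Sum>i<n. D (g (\<lambda>_. 0) i) (g (\<lambda>_. 1) i)) = real (p ^ p) * (\<Sum>j<k. D 0 1)"
      by (rule scaled_map_sum[OF g]) (simp_all add: D_def)
    then show False
      using \<open>\<not> n > 0\<close> assms(2) p0 by (simp add: D_def)
  qed
  moreover
  define c where "c = real p powr (- real p / 2)"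
  define S where "S = dilate n c (cart_pow C n)"
  have "\<exists>X. copy_in k (cart_pow C k) n S X \<and> (monochromatic R X \<or> rainbow R X)"
    if R: "colouring S R" for R
  proof -
    define pt where "pt x = (\<lambda>i\<in>{..<n}. c *\<^sub>R P (x i))" for x
    have ptS: "pt x \<in> S" for x
    proof -
      have "(\<lambda>i\<in>{..<n}. P (x i)) \<in> cart_pow C n"
        using PC by (auto simp: cart_pow_def)
      moreover have "pt x = (\<lambda>i\<in>{..<n}. c *\<^sub>R (\<lambda>i\<in>{..<n}. P (x i)) i)"
        by (auto simp: pt_def)
      ultimately show ?thesis
        unfolding S_def dilate_def by blast
    qed
    define E where "E x y \<longleftrightarrow> (pt x, pt y) \<in> R" for x y
    have eqR: "equiv S R" using R by (simp add: colouring_def)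
    have "refl_on S R" "sym R" "trans R"
      using eqR by (auto elim: equivE)
    have "equivp E"
    proof (intro equivpI reflpI sympI transpI)
      show "E x x" for x
        unfolding E_def using \<open>refl_on S R\<close> ptS by (rule refl_onD)
      show "E y x" if "E x y" for x y
        using \<open>sym R\<close> that unfolding E_def by (rule symD)
      show "E x z" if "E x y" "E y z" for x y z
        using \<open>trans R\<close> that unfolding E_def by (rule transD)
    qed
    moreover have "E x y" if xy: "agree p n x y" for x y
    proof -
      have "P (x i) = P (y i)" if "i < n" for i
        using xy that by (intro P(2)) (simp add: agree_def)
      then have "pt x = pt y"
        unfolding pt_def by (intro restrict_ext) simp
      then show ?thesis
        unfolding E_def using \<open>refl_on S R\<close> ptS by (simp add: refl_onD)
    qed
    ultimately have "word_colouring p n E" by (simp add: word_colouring_def)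
    then obtain g where g: "scaled_map p (p ^ p) k n g"
      and col: "(\<forall>x y. E (g x) (g y)) \<or> (\<forall>x y. E (g x) (g y) \<longrightarrow> agree p k x y)"
      using n by blast
    define idx where "idx v = (SOME a. P a = v)" for v
    have idx: "P (idx v) = v" if "v \<in> C" for v
    proof -
      have "\<exists>a. P a = v" using that P(1) by auto
      then show ?thesis unfolding idx_def by (rule someI_ex)
    qed
    define wd where "wd z = (\<lambda>i. idx (z i))" for z :: point
    have wd: "P (wd z i) = z i" if "z \<in> cart_pow C k" "i < k" for z i
      using that by (auto simp: wd_def cart_pow_def intro!: idx)
    define X where "X = (\<lambda>z. pt (g (wd z))) ` cart_pow C k"
    have c2: "c\<^sup>2 * real (p ^ p) = 1"
    proof -
      have "c\<^sup>2 = real p powr (- real p)"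
        using p0 by (simp add: c_def power2_eq_square flip: powr_add)
      then show ?thesis
        using p0 by (simp add: powr_minus powr_realpow)
    qed
    have isom: "edist n (pt (g (wd y))) (pt (g (wd z))) = edist k y z"
      if yz: "y \<in> cart_pow C k" "z \<in> cart_pow C k" for y z
    proof -
      let ?D = "\<lambda>a b. (dist (P a) (P b))\<^sup>2"
      have "(\<Sum>i<n. (dist (pt (g (wd y)) i) (pt (g (wd z)) i))\<^sup>2) =
          (\<Sum>i<n. c\<^sup>2 * ?D (g (wd y) i) (g (wd z) i))"
        by (intro sum.cong refl)
          (simp add: pt_def dist_norm power_mult_distrib flip: scaleR_diff_right)
      also have "\<dots> = c\<^sup>2 * (\<Sum>i<n. ?D (g (wd y) i) (g (wd z) i))"
        by (simp add: sum_distrib_left)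
      also have "(\<Sum>i<n. ?D (g (wd y) i) (g (wd z) i)) = real (p ^ p) * (\<Sum>j<k. ?D (wd y j) (wd z j))"
        using scaled_map_sum[OF g, where D = ?D] P(3) by simp
      also have "(\<Sum>j<k. ?D (wd y j) (wd z j)) = (\<Sum>j<k. (dist (y j) (z j))\<^sup>2)"
        using wd yz by (intro sum.cong refl) simp
      also have "c\<^sup>2 * (real (p ^ p) * \<dots>) = \<dots>"
        using c2 by (simp only: mult.assoc[symmetric] mult_1)
      finally show ?thesis by (simp add: edist_def L2_set_def)
    qed
    have "copy_in k (cart_pow C k) n S X"
      unfolding copy_in_def X_def using ptS isom by blast
    moreover have "monochromatic R X" if "\<forall>x y. E (g x) (g y)"
      using that by (auto simp: monochromatic_def X_def E_def)
    moreover have "rainbow R X" if sep: "\<forall>x y. E (g x) (g y) \<longrightarrow> agree p k x y"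
    proof -
      have "y = z" if yz: "y \<in> cart_pow C k" "z \<in> cart_pow C k"
        and "(pt (g (wd y)), pt (g (wd z))) \<in> R" for y z
      proof -
        have agr: "agree p k (wd y) (wd z)" using sep that by (simp add: E_def)
        have "P (wd y i) = P (wd z i)" if "i < k" for i
          using agr that by (intro P(2)) (simp add: agree_def)
        then have "y i = z i" if "i \<in> {..<k}" for i
          using wd yz that by (metis lessThan_iff)
        then show ?thesis
          using yz unfolding cart_pow_def by (rule PiE_ext[rotated 2])
      qed
      then show ?thesis
        unfolding rainbow_def X_def by blast
    qed
    ultimately show ?thesis using col by blast
  qed
  ultimately show ?thesis
    unfolding S_def c_def by blast
qed

end
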